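(* Let $s\ge 2$ and $r>1$ be integers, and let $L_{r,s}$ be the smallest value obtained in $r$ rolls of a fair $s$-sided die. Then $$E[L_{r,s}]=1+\frac{\sum_{i=1}^{s-1}i^r}{s^r}.$$
   Context: A fair $s$-sided die takes each value in $\{1,\dots,s\}$ with equal probability. A disadvantage experiment consists of rolling the die $r$ times (independently, so that all $s^r$ sequences in $\{1,\dots,s\}^r$ are equally likely) and taking the smallest number rolled as the outcome. $L_{r,s}$ is the random variable giving this outcome, i.e. $L_{r,s}=\min(X_1,\dots,X_r)$ with $X_1,\dots,X_r$ independent and uniform on $\{1,\dots,s\}$. *)

theory Defs
  imports "HOL-Probability.Probability"
begin

text \<open>The rolls live on an arbitrary probability space \<open>M\<close>; only \<open>X 1, \<dots>, X r\<close> matter.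
  The probability mass function makes each marginal a measure on all of \<open>nat\<close>,
  so a roll lies in \<open>{1..s}\<close> almost surely.\<close>

definition fair_die_rolls :: "'a measure \<Rightarrow> nat \<Rightarrow> nat \<Rightarrow> (nat \<Rightarrow> 'a \<Rightarrow> nat) \<Rightarrow> bool" where
  "fair_die_rolls M r s X \<longleftrightarrow>
     prob_space M \<and>
     prob_space.indep_vars M (\<lambda>_. count_space UNIV) X {1..r} \<and>
     (\<forall>i\<in>{1..r}. distr M (count_space UNIV) (X i) = measure_pmf (pmf_of_set {1..s}))"

text \<open>The outcome $L_{r,s}$ of the disadvantage experiment.\<close>

definition lowest_roll :: "nat \<Rightarrow> (nat \<Rightarrow> 'a \<Rightarrow> nat) \<Rightarrow> 'a \<Rightarrow> nat" where
  "lowest_roll r X \<omega> = Min ((\<lambda>i. X i \<omega>) ` {1..r})"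

text \<open>The canonical experiment, with sequences of rolls drawn from a product distribution,
  is an instance.\<close>

lemma fair_die_rolls_Pi_pmf:
  "fair_die_rolls (measure_pmf (Pi_pmf {1..r} d (\<lambda>_. pmf_of_set {1..s}))) r s (\<lambda>i f. f i)"
proof -
  have "distr (measure_pmf (Pi_pmf {1..r} d (\<lambda>_. pmf_of_set {1..s}))) (count_space UNIV) (\<lambda>f. f i)
          = measure_pmf (pmf_of_set {1..s})" if "i \<in> {1..r}" for i
    using Pi_pmf_component[of "{1..r}" i d "\<lambda>_. pmf_of_set {1..s}"] that
    by (simp flip: map_pmf_rep_eq)
  then show ?thesis
    unfolding fair_die_rolls_def
    using indep_vars_Pi_pmf[of "{1..r}" d "\<lambda>_. pmf_of_set {1..s}"]
    by (auto simp: measure_pmf.prob_space_axioms)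
qed

end

theory Submission
  imports Defs
begin

text \<open>The tail-sum formula: almost surely \<open>L \<le> s\<close>, so \<open>L\<close> is the number of \<open>k \<in> {1..s}\<close> with
  \<open>k \<le> L\<close>, and by independence \<open>P(L \<ge> k) = ((s + 1 - k) / s) ^ r\<close>.\<close>

context
  fixes M :: "'a measure" and X :: "nat \<Rightarrow> 'a \<Rightarrow> nat" and r s :: nat
  assumes fair: "fair_die_rolls M r s X"
begin

interpretation prob_space M
  using fair by (simp add: fair_die_rolls_def)

lemma roll_measurable:
  assumes "i \<in> {1..r}"
  shows "X i \<in> M \<rightarrow>\<^sub>M count_space UNIV"
  using fair assms by (auto simp: fair_die_rolls_def indep_vars_def)

lemma prob_roll:
  assumes "i \<in> {1..r}"
  shows "prob (X i -` A \<inter> space M) = measure_pmf.prob (pmf_of_set {1..s}) A"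
proof -
  have "prob (X i -` A \<inter> space M) = measure (distr M (count_space UNIV) (X i)) A"
    using roll_measurable[OF assms] by (simp add: measure_distr)
  then show ?thesis
    using fair assms by (simp add: fair_die_rolls_def)
qed

text \<open>The bound \<open>1 \<le> k\<close> keeps exactly the faces \<open>{k..s}\<close>, and
  \<open>k \<le> s\<close> makes the die nonempty, so that \<open>pmf_of_set {1..s}\<close> really
  is uniform.\<close>

lemma prob_roll_ge:
  assumes "i \<in> {1..r}" "k \<in> {1..s}"
  shows "prob (X i -` {k..} \<inter> space M) = real (s + 1 - k) / real s"
proof -
  have "{1..s} \<inter> {k..} = {k..s}"
    using assms by auto
  then show ?thesis
    using assms by (simp add: prob_roll measure_pmf_of_set)
qed

text \<open>Only the law of a roll is fixed, so values above \<open>s\<close> can occur on a null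
  set; the tail sum must stop at \<open>s\<close> all the same.\<close>

lemma AE_roll_le:
  assumes "i \<in> {1..r}" "s > 0"
  shows "AE \<omega> in M. X i \<omega> \<le> s"
proof -
  have "{1..s} \<inter> {..s} = {1..s}"
    by auto
  then have "prob (X i -` {..s} \<inter> space M) = 1"
    using assms by (simp add: prob_roll measure_pmf_of_set)
  then have "AE \<omega> in M. \<omega> \<in> X i -` {..s} \<inter> space M"
    using measurable_sets[OF roll_measurable[OF assms(1)]] by (subst prob_eq_1[symmetric]) auto
  then show ?thesis
    by auto
qed

text \<open>This is the shape that independence factorises. With \<open>r > 0\<close> the minimum is
  over a nonempty set, and the intersection stays inside \<open>space M\<close> instead of being
  \<open>UNIV\<close>.\<close>

lemma lowest_roll_ge_eq:
  assumes "r > 0"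
  shows "{\<omega> \<in> space M. k \<le> lowest_roll r X \<omega>} = (\<Inter>i\<in>{1..r}. X i -` {k..} \<inter> space M)"
  using assms by (auto simp: lowest_roll_def)

lemma lowest_roll_ge_event:
  assumes "r > 0"
  shows "{\<omega> \<in> space M. k \<le> lowest_roll r X \<omega>} \<in> events"
  unfolding lowest_roll_ge_eq[OF assms]
  using assms measurable_sets[OF roll_measurable] by (intro sets.finite_INT) auto

lemma prob_lowest_roll_ge:
  assumes "r > 0" "k \<in> {1..s}"
  shows "prob {\<omega> \<in> space M. k \<le> lowest_roll r X \<omega>} = (real (s + 1 - k) / real s) ^ r"
proof -
  have "indep_vars (\<lambda>_. count_space UNIV) X {1..r}"
    using fair by (simp add: fair_die_rolls_def)
  then have "prob (\<Inter>i\<in>{1..r}. X i -` {k..} \<inter> space M)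
      = (\<Prod>i\<in>{1..r}. prob (X i -` {k..} \<inter> space M))"
    using assms by (intro indep_varsD) auto
  also have "\<dots> = (\<Prod>i\<in>{1..r}. real (s + 1 - k) / real s)"
    by (intro prod.cong refl prob_roll_ge assms(2))
  finally show ?thesis
    using assms by (simp add: lowest_roll_ge_eq)
qed

lemma expectation_lowest_roll:
  assumes "r > 0" "s > 0"
  shows "expectation (\<lambda>\<omega>. real (lowest_roll r X \<omega>)) = 1 + (\<Sum>i = 1..s - 1. real i ^ r) / real s ^ r"
proof -
  let ?E = "\<lambda>k. {\<omega> \<in> space M. k \<le> lowest_roll r X \<omega>}"
  note event = lowest_roll_ge_event[OF assms(1)]
  have meas: "(\<lambda>\<omega>. real (lowest_roll r X \<omega>)) \<in> borel_measurable M"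
  proof -
    \<comment> \<open>A real threshold on an integer value rounds up; a negative one becomes 0 and
      gives the whole space.\<close>
    have "{\<omega> \<in> space M. a \<le> real (lowest_roll r X \<omega>)} = ?E (nat \<lceil>a\<rceil>)" for a
      by (auto simp: nat_le_iff ceiling_le_iff)
    then show ?thesis
      using event by (simp only: borel_measurable_iff_ge simp_thms)
  qed
  \<comment> \<open>Bounding a single roll suffices, since the minimum lies below each of them; roll
    1 exists as \<open>r > 0\<close>.\<close>
  have "AE \<omega> in M. X 1 \<omega> \<le> s"
    using assms by (intro AE_roll_le) auto
  then have "AE \<omega> in M. real (lowest_roll r X \<omega>) = (\<Sum>k\<in>{1..s}. indicator (?E k) \<omega>)"
    using AE_space
  proof eventually_elim
    case (elim \<omega>)
    have "lowest_roll r X \<omega> \<le> X 1 \<omega>"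
      using assms by (simp add: lowest_roll_def)
    \<comment> \<open>The indicators equal to 1 are those with index in this set, whose cardinality
      is the minimum itself, even if that is 0.\<close>
    then have "{1..s} \<inter> {k. k \<le> lowest_roll r X \<omega>} = {1..lowest_roll r X \<omega>}"
      using elim assms by auto
    then show ?case
      using elim by (simp add: indicator_def)
  qed
  then have "expectation (\<lambda>\<omega>. real (lowest_roll r X \<omega>))
      = expectation (\<lambda>\<omega>. \<Sum>k\<in>{1..s}. indicator (?E k) \<omega>)"
    using event meas by (intro integral_cong_AE) auto
  also have "\<dots> = (\<Sum>k\<in>{1..s}. prob (?E k))"
    using event by (subst Bochner_Integration.integral_sum) (auto simp: less_top[symmetric])
  also have "\<dots> = (\<Sum>k\<in>{1..s}. (real (s + 1 - k) / real s) ^ r)"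
    by (intro sum.cong refl prob_lowest_roll_ge assms(1))
  also have "\<dots> = (\<Sum>j\<in>{1..s}. (real j / real s) ^ r)"
    \<comment> \<open>Reversing the order of summation: \<open>k \<mapsto> s + 1 - k\<close> is an
      involution of \<open>{1..s}\<close>.\<close>
    by (rule sum.reindex_bij_witness[of _ "\<lambda>j. s + 1 - j" "\<lambda>k. s + 1 - k"]) auto
  also have "\<dots> = (\<Sum>j\<in>{1..s}. real j ^ r) / real s ^ r"
    by (simp add: power_divide sum_divide_distrib)
  \<comment> \<open>The top term \<open>s ^ r\<close>, divided by \<open>s ^ r\<close>, becomes the
    summand 1 of the formula.\<close>
  also have "{1..s} = insert s {1..s - 1}"
    using assms by auto
  also have "(\<Sum>j\<in>\<dots>. real j ^ r) = real s ^ r + (\<Sum>j = 1..s - 1. real j ^ r)"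
    using assms by (subst sum.insert) auto
  finally show ?thesis
    using assms by (simp add: add_divide_distrib)
qed

end

theorem theorem2p4:
  fixes M :: "'a measure" and X :: "nat \<Rightarrow> 'a \<Rightarrow> nat" and r s :: nat
  assumes "s \<ge> 2" and "r > 1"
    and "fair_die_rolls M r s X"
  shows "prob_space.expectation M (\<lambda>\<omega>. real (lowest_roll r X \<omega>))
           = 1 + (\<Sum>i = 1..s - 1. real i ^ r) / real s ^ r"
  using assms by (intro expectation_lowest_roll) auto

end
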